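(* For every integer $n\geq 2$, the Hilbert series $h_n(t)=\sum_{k\ge 0} t^k\dim_F (R_n/J_n)_k$ of the graded Artinian $F$-algebra $R_n/J_n$ is \[ h_n(t)=\sum_{k=0}^{2n-4} a_{n,k}\,t^k. \]
   Context: $F$ is an algebraically closed field of characteristic $0$, and $R_n=F[x_1,\ldots,x_n]$ with its standard grading ($\deg x_i=1$). For $n\geq 3$, $I_n\lhd R_n$ is the ideal generated by the $n$ polynomials $\left(\prod_{j\neq i}x_j\right)-x_i$, $1\leq i\leq n$; for $n=2$ one sets $I_2=\langle x_1,x_2\rangle\lhd F[x_1,x_2]$. Equip $R_n$ with the graded reverse lexicographic monomial order with $x_1>x_2>\cdots>x_n$, and let $J_n=\mathrm{in}_{\mathrm{GRevLex}}(I_n)\lhd R_n$ be the initial ideal of $I_n$, i.e. the monomial ideal generated by the leading monomials of all nonzero elements of $I_n$. The quotient $R_n/J_n$ is finite-dimensional over $F$. The integers $a_{n,k}$ (rows of the symmetrised Bernoulli triangle) are defined as follows. For $m\geq 0$ and $0\leq k\leq m$ let $b_{m,k}=\sum_{j=0}^{k}\binom{m}{j}$. For $n\geq 2$ and $0\leq k\leq 2n-4$ let $a_{n,k}=b_{n-1,k}$ if $0\leq k\leq n-2$, and $a_{n,k}=b_{n-1,2n-4-k}$ if $n-2\leq k\leq 2n-4$. *)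

theory Defs
  imports
    "HOL-Library.Poly_Mapping"
    "HOL-Computational_Algebra.Polynomial"
    "HOL-Computational_Algebra.Formal_Power_Series"
    "HOL-Algebra.QuotRing"
    "HOL-Algebra.Embedded_Algebras"
begin

text \<open>
  Monomials are finitely supported exponent vectors, and polynomials over \<open>'a\<close> are finitely
  supported functions from monomials to \<open>'a\<close>; the type admits all variables \<open>x\<^sub>i\<close> with
  \<open>i :: nat\<close>, and \<open>F[x\<^sub>1, \<dots>, x\<^sub>n]\<close> is carved out as a carrier set.
\<close>

type_synonym mon = "nat \<Rightarrow>\<^sub>0 nat"

type_synonym 'a mpol = "mon \<Rightarrow>\<^sub>0 'a"

definition mon_deg :: "mon \<Rightarrow> nat" where
  "mon_deg m = (\<Sum>i\<in>Poly_Mapping.keys m. Poly_Mapping.lookup m i)"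

definition monomial :: "mon \<Rightarrow> 'a::field mpol" where
  "monomial m = Poly_Mapping.single m 1"

definition var :: "nat \<Rightarrow> 'a::field mpol" where
  "var i = monomial (Poly_Mapping.single i 1)"

definition const :: "'a::field \<Rightarrow> 'a mpol" where
  "const c = Poly_Mapping.single 0 c"

definition poly_ring :: "nat \<Rightarrow> 'a::field mpol ring" where
  "poly_ring n =
     \<lparr>carrier = {p. \<forall>m\<in>Poly_Mapping.keys p. Poly_Mapping.keys m \<subseteq> {1..n}},
      mult = (*), one = 1, zero = 0, add = (+)\<rparr>"

definition homogeneous_part :: "nat \<Rightarrow> nat \<Rightarrow> 'a::field mpol set" where
  "homogeneous_part n k =
     {p \<in> carrier (poly_ring n). \<forall>m\<in>Poly_Mapping.keys p. mon_deg m = k}"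

text \<open>
  Graded reverse lexicographic order with \<open>x\<^sub>1 > x\<^sub>2 > \<dots>\<close>: \<open>a\<close> is smaller than \<open>b\<close> if its degree
  is smaller, or if the degrees agree and the last nonzero entry of \<open>a - b\<close> is positive.
\<close>

definition grevlex_less :: "mon \<Rightarrow> mon \<Rightarrow> bool" where
  "grevlex_less a b \<longleftrightarrow>
     mon_deg a < mon_deg b \<or>
     mon_deg a = mon_deg b \<and>
       (\<exists>i. Poly_Mapping.lookup a i > Poly_Mapping.lookup b i \<and>
            (\<forall>j>i. Poly_Mapping.lookup a j = Poly_Mapping.lookup b j))"

text \<open>Meaningful for nonzero \<open>p\<close> only; see \<open>leading_mon_unique\<close> below.\<close>

definition leading_mon :: "'a::field mpol \<Rightarrow> mon" where
  "leading_mon p =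
     (THE m. m \<in> Poly_Mapping.keys p \<and>
             (\<forall>m'\<in>Poly_Mapping.keys p. m' \<noteq> m \<longrightarrow> grevlex_less m' m))"

definition initial_ideal :: "nat \<Rightarrow> 'a::field mpol set \<Rightarrow> 'a mpol set" where
  "initial_ideal n I = Idl\<^bsub>poly_ring n\<^esub> ((\<lambda>p. monomial (leading_mon p)) ` (I - {0}))"

text \<open>The case \<open>n = 2\<close> is a separate convention; values for \<open>n < 2\<close> are irrelevant.\<close>

definition ideal_I :: "nat \<Rightarrow> 'a::field mpol set" where
  "ideal_I n =
     (if n = 2 then Idl\<^bsub>poly_ring n\<^esub> {var 1, var 2}
      else Idl\<^bsub>poly_ring n\<^esub> ((\<lambda>i. (\<Prod>j\<in>{1..n} - {i}. var j) - var i) ` {1..n}))"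

definition ideal_J :: "nat \<Rightarrow> 'a::field mpol set" where
  "ideal_J n = initial_ideal n (ideal_I n)"

text \<open>
  For a homogeneous ideal \<open>J\<close>, the degree-\<open>k\<close> component of \<open>F[x\<^sub>1, \<dots>, x\<^sub>n] / J\<close> is the image of
  the forms of degree \<open>k\<close>, and the scalars are the image of the constant polynomials.
\<close>

definition hilbert_function :: "nat \<Rightarrow> 'a::field mpol set \<Rightarrow> nat \<Rightarrow> nat" where
  "hilbert_function n J k =
     ring.dim (poly_ring n Quot J)
       ((\<lambda>p. J +>\<^bsub>poly_ring n\<^esub> p) ` Set.range const)
       ((\<lambda>p. J +>\<^bsub>poly_ring n\<^esub> p) ` homogeneous_part n k)"

definition hilbert_series :: "nat \<Rightarrow> 'a::field mpol set \<Rightarrow> int fps" where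
  "hilbert_series n J = Abs_fps (\<lambda>k. int (hilbert_function n J k))"

definition bernoulli_b :: "nat \<Rightarrow> nat \<Rightarrow> nat" where
  "bernoulli_b m k = (\<Sum>j=0..k. m choose j)"

definition bernoulli_a :: "nat \<Rightarrow> nat \<Rightarrow> nat" where
  "bernoulli_a n k =
     (if k \<le> n - 2 then bernoulli_b (n - 1) k else bernoulli_b (n - 1) (2 * n - 4 - k))"


lemma grevlex_less_irrefl: "\<not> grevlex_less a a"
  by (simp add: grevlex_less_def)

lemma grevlex_less_trans:
  assumes "grevlex_less a b" "grevlex_less b c"
  shows "grevlex_less a c"
proof (cases "mon_deg a = mon_deg b \<and> mon_deg b = mon_deg c")
  case False
  then show ?thesis using assms by (auto simp: grevlex_less_def)
next
  case True
  then obtain i i' where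
    i: "Poly_Mapping.lookup a i > Poly_Mapping.lookup b i"
       "\<forall>j>i. Poly_Mapping.lookup a j = Poly_Mapping.lookup b j" and
    i': "Poly_Mapping.lookup b i' > Poly_Mapping.lookup c i'"
       "\<forall>j>i'. Poly_Mapping.lookup b j = Poly_Mapping.lookup c j"
    using assms by (auto simp: grevlex_less_def)
  have "Poly_Mapping.lookup a (max i i') > Poly_Mapping.lookup c (max i i')"
    using i i' by (cases i i' rule: linorder_cases) (auto simp: max_def)
  moreover have "\<forall>j>max i i'. Poly_Mapping.lookup a j = Poly_Mapping.lookup c j"
    using i i' by auto
  ultimately show ?thesis using True by (auto simp: grevlex_less_def)
qed

lemma grevlex_less_linear: "a = b \<or> grevlex_less a b \<or> grevlex_less b a"
proof (cases "a = b")
  case False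
  define D where "D = {i. Poly_Mapping.lookup a i \<noteq> Poly_Mapping.lookup b i}"
  have "D \<subseteq> Poly_Mapping.keys a \<union> Poly_Mapping.keys b"
    by (auto simp: D_def in_keys_iff)
  then have fin: "finite D" by (rule finite_subset) simp
  have ne: "D \<noteq> {}"
  proof
    assume "D = {}"
    then have "a = b" unfolding D_def by (intro poly_mapping_eqI) blast
    with False show False ..
  qed
  define i where i: "i = Max D"
  have iD: "i \<in> D" unfolding i using fin ne by (rule Max_in)
  have eq: "Poly_Mapping.lookup a j = Poly_Mapping.lookup b j" if "j > i" for j
    using Max_ge[OF fin, of j] that unfolding i D_def by auto
  consider "Poly_Mapping.lookup a i < Poly_Mapping.lookup b i"
    | "Poly_Mapping.lookup a i > Poly_Mapping.lookup b i"
    using iD unfolding D_def by fastforce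
  then show ?thesis
  proof cases
    case 1
    then have "\<exists>i. Poly_Mapping.lookup b i > Poly_Mapping.lookup a i \<and>
                   (\<forall>j>i. Poly_Mapping.lookup b j = Poly_Mapping.lookup a j)"
      using eq by (intro exI[of _ i]) simp
    then show ?thesis unfolding grevlex_less_def
      by (cases "mon_deg a" "mon_deg b" rule: linorder_cases) simp_all
  next
    case 2
    then have "\<exists>i. Poly_Mapping.lookup a i > Poly_Mapping.lookup b i \<and>
                   (\<forall>j>i. Poly_Mapping.lookup a j = Poly_Mapping.lookup b j)"
      using eq by (intro exI[of _ i]) simp
    then show ?thesis unfolding grevlex_less_def
      by (cases "mon_deg a" "mon_deg b" rule: linorder_cases) simp_all
  qed
qed simp

lemma leading_mon_unique:
  fixes p :: "'a::field mpol"
  assumes "p \<noteq> 0"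
  shows "\<exists>!m. m \<in> Poly_Mapping.keys p \<and>
                (\<forall>m'\<in>Poly_Mapping.keys p. m' \<noteq> m \<longrightarrow> grevlex_less m' m)"
proof -
  have "\<exists>m\<in>S. \<forall>m'\<in>S. m' \<noteq> m \<longrightarrow> grevlex_less m' m" if "finite S" "S \<noteq> {}" for S
    using that
  proof (induction S rule: finite_ne_induct)
    case (insert x S)
    then obtain m where m: "m \<in> S" "\<forall>m'\<in>S. m' \<noteq> m \<longrightarrow> grevlex_less m' m" by blast
    consider "x = m" | "grevlex_less x m" | "grevlex_less m x"
      using grevlex_less_linear[of x m] by blast
    then show ?case
    proof cases
      case 3
      then have "\<forall>m'\<in>S. grevlex_less m' x"
        using m grevlex_less_trans[OF _ 3] by metis
      then show ?thesis by blast
    qed (use m in blast)+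
  qed simp
  moreover have "Poly_Mapping.keys p \<noteq> {}" using assms by simp
  ultimately obtain m where m: "m \<in> Poly_Mapping.keys p"
      "\<forall>m'\<in>Poly_Mapping.keys p. m' \<noteq> m \<longrightarrow> grevlex_less m' m"
    using finite_keys by blast
  show ?thesis
  proof (rule ex1I[of _ m])
    fix m2
    assume m2: "m2 \<in> Poly_Mapping.keys p \<and>
                (\<forall>m'\<in>Poly_Mapping.keys p. m' \<noteq> m2 \<longrightarrow> grevlex_less m' m2)"
    show "m2 = m"
    proof (rule ccontr)
      assume ne: "m2 \<noteq> m"
      have "grevlex_less m2 m" using m m2 ne by blast
      moreover have "grevlex_less m m2" using m m2 ne[symmetric] by blast
      ultimately show False using grevlex_less_trans grevlex_less_irrefl by blast
    qed
  qed (use m in blast)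
qed

lemma poly_ring_carrier_times:
  fixes p q :: "'a::field mpol"
  assumes "p \<in> carrier (poly_ring n)" "q \<in> carrier (poly_ring n)"
  shows "p * q \<in> carrier (poly_ring n)"
proof -
  have "Poly_Mapping.keys m \<subseteq> {1..n}" if m: "m \<in> Poly_Mapping.keys (p * q)" for m
  proof -
    obtain a b where ab: "m = a + b" "a \<in> Poly_Mapping.keys p" "b \<in> Poly_Mapping.keys q"
      using subsetD[OF keys_mult m] by blast
    have "Poly_Mapping.keys a \<subseteq> {1..n}" "Poly_Mapping.keys b \<subseteq> {1..n}"
      using assms ab(2,3) unfolding poly_ring_def by auto
    with keys_add[of a b] show ?thesis unfolding ab(1) by (meson Un_least subset_trans)
  qed
  then show ?thesis by (simp add: poly_ring_def)
qed

lemma cring_poly_ring: "cring (poly_ring n :: 'a::field mpol ring)"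
proof (rule cringI)
  let ?R = "poly_ring n :: 'a mpol ring"
  show "abelian_group ?R"
  proof (rule abelian_groupI)
    fix x y assume "x \<in> carrier ?R" "y \<in> carrier ?R"
    then show "x \<oplus>\<^bsub>?R\<^esub> y \<in> carrier ?R"
      using keys_add[of x y] by (fastforce simp: poly_ring_def)
  next
    fix x assume "x \<in> carrier ?R"
    then show "\<exists>y\<in>carrier ?R. y \<oplus>\<^bsub>?R\<^esub> x = \<zero>\<^bsub>?R\<^esub>"
      by (intro bexI[of _ "- x"]) (auto simp: poly_ring_def)
  qed (auto simp: poly_ring_def add_ac)
  show "comm_monoid ?R"
  proof (rule comm_monoidI)
    fix x y assume "x \<in> carrier ?R" "y \<in> carrier ?R"
    then have "x * y \<in> carrier ?R" by (rule poly_ring_carrier_times)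
    then show "x \<otimes>\<^bsub>?R\<^esub> y \<in> carrier ?R" by (simp add: poly_ring_def)
  qed (auto simp: poly_ring_def mult_ac)
qed (auto simp: poly_ring_def algebra_simps)

end

theory Submission
  imports Defs
begin

text \<open>
  Call a monomial of $x_1,\dots,x_n$ standard if it has the form $x_S x_n^e$ with
  $S \subseteq \{1,\dots,n-1\}$ and $2|S| + e \le 2n-4$. The claim is that $J_n$ is spanned by
  the monomials that are not standard; the Hilbert function then counts standard monomials by
  degree, and those of degree $k$ correspond to the sets $S$ with $|S| \le \min(k, 2n-4-k)$,
  of which there are $a_{n,k}$.
  
  For $n \ge 3$ the ideal $I_n$ is generated by differences of monomials, so it is governed by
  the congruence that identifies two monomials whose difference lies in $I_n$. Multiplying the
  generators by suitable monomials gives $x_i^2 \equiv x_n^2$, and, for $T \subseteq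
  \{1,\dots,n-1\}$ with complement $S$ and $t = |T| \ge 1$,
  \[ x_S\, x_n^{2t-1} \equiv x_T, \]
  where the left side has larger degree $n-2+t$. Together with
  $x_1 \cdots x_{n-1} \equiv x_n$ these relations make every nonstandard monomial divisible by
  the leading monomial of an element of $I_n$ (\<open>nonstandard_reducible\<close>).
  
  Conversely, no leading monomial of $I_n$ is standard (\<open>leading_mon_not_standard\<close>). Congruent
  monomials have exponent vectors that differ by an element of the lattice spanned by the vectors
  $(1,\dots,1) - 2e_i$, and the monomial $1$ is congruent only to itself. For an element
  of $I_n$ the coefficients in each class of this coarser relation sum to zero, so no class meets
  its support in exactly one monomial. A standard monomial is strictly the smallest of its class
  (\<open>standard_least_linked\<close>), hence it cannot be a leading monomial: the other
  members of its class in the support would be larger.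

  For $n = 2$ the only standard monomial is $1$, and $I_2$ consists of the polynomials without
  constant term.
\<close>

section \<open>Polynomials and monomials in finitely many variables\<close>

abbreviation exponent :: "mon \<Rightarrow> nat \<Rightarrow> nat" where
  "exponent \<equiv> Poly_Mapping.lookup"

abbreviation coefficient :: "'a::field mpol \<Rightarrow> mon \<Rightarrow> 'a" where
  "coefficient \<equiv> Poly_Mapping.lookup"

abbreviation support :: "'a::field mpol \<Rightarrow> mon set" where
  "support \<equiv> Poly_Mapping.keys"

definition monomials :: "nat \<Rightarrow> mon set" where
  "monomials n = {m. Poly_Mapping.keys m \<subseteq> {1..n}}"

lemma in_monomials_iff: "m \<in> monomials n \<longleftrightarrow> (\<forall>i. i \<notin> {1..n} \<longrightarrow> exponent m i = 0)"
  unfolding monomials_def by (auto simp: in_keys_iff subset_iff)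

lemma zero_in_monomials [simp]: "0 \<in> monomials n"
  by (simp add: in_monomials_iff)

lemma add_in_monomials_iff [simp]: "a + b \<in> monomials n \<longleftrightarrow> a \<in> monomials n \<and> b \<in> monomials n"
  by (auto simp: in_monomials_iff lookup_add)

lemma single_in_monomials [simp]: "i \<in> {1..n} \<Longrightarrow> Poly_Mapping.single i k \<in> monomials n"
  by (auto simp: in_monomials_iff lookup_single when_def)

lemma in_poly_ring_iff: "p \<in> carrier (poly_ring n) \<longleftrightarrow> support p \<subseteq> monomials n"
  by (auto simp: poly_ring_def monomials_def)

lemma poly_ring_simps [simp]:
  "mult (poly_ring n) = (*)" "one (poly_ring n) = 1"
  "zero (poly_ring n) = 0" "add (poly_ring n) = (+)"
  by (simp_all add: poly_ring_def)

lemma ring_poly_ring: "ring (poly_ring n :: 'a::field mpol ring)"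
  using cring_poly_ring by (rule cring.axioms(1))

lemma support_uminus [simp]: "support (- p) = support p"
  by (auto simp: in_keys_iff)

lemma support_diff: "support (p - q) \<subseteq> support p \<union> support q"
  by (auto simp: in_keys_iff lookup_minus)

lemma coefficient_monomial: "coefficient (monomial m) m' = (1 when m = m')"
  by (simp add: monomial_def lookup_single)

lemma support_monomial [simp]: "support (monomial m) = {m}"
  by (simp add: monomial_def)

lemma monomial_mult: "monomial a * monomial b = monomial (a + b)"
  by (simp add: monomial_def mult_single)

lemma monomial_zero: "monomial 0 = 1"
  by (simp add: monomial_def)

lemma const_mult_monomial: "const c * monomial m = Poly_Mapping.single m c"
  by (simp add: const_def monomial_def mult_single)

lemma support_const: "support (const c) \<subseteq> {0}"
  by (simp add: const_def)

lemma sum_of_terms: "(\<Sum>m\<in>support p. Poly_Mapping.single m (coefficient p m)) = p"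
  by (rule poly_mapping_eqI)
    (simp add: lookup_sum lookup_single when_def sum.delta' in_keys_iff)

lemma ideal_poly_ringI:
  fixes S :: "'a::field mpol set"
  assumes "S \<subseteq> carrier (poly_ring n)" "0 \<in> S"
    and add: "\<And>p q. p \<in> S \<Longrightarrow> q \<in> S \<Longrightarrow> p + q \<in> S"
    and mult: "\<And>r p. r \<in> carrier (poly_ring n) \<Longrightarrow> p \<in> S \<Longrightarrow> r * p \<in> S"
  shows "ideal S (poly_ring n)"
proof -
  interpret R: cring "poly_ring n :: 'a mpol ring" by (rule cring_poly_ring)
  show ?thesis
  proof (rule idealI)
    show "ring (poly_ring n :: 'a mpol ring)" by (rule ring_poly_ring)
    show "subgroup S (add_monoid (poly_ring n))"
    proof (rule R.add.subgroupI)
      fix p assume p: "p \<in> S"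
      have "- 1 \<in> carrier (poly_ring n :: 'a mpol ring)"
        by (simp add: in_poly_ring_iff)
      then have "(- 1) * p \<in> S" using p by (rule mult)
      moreover have "\<ominus>\<^bsub>poly_ring n\<^esub> p = - p"
        by (rule R.minus_equality) (use subsetD[OF assms(1) p] in \<open>simp_all add: in_poly_ring_iff\<close>)
      ultimately show "\<ominus>\<^bsub>poly_ring n\<^esub> p \<in> S" by simp
    qed (use assms in auto)
    fix p r assume "p \<in> S" "r \<in> carrier (poly_ring n :: 'a mpol ring)"
    then show "r \<otimes>\<^bsub>poly_ring n\<^esub> p \<in> S" "p \<otimes>\<^bsub>poly_ring n\<^esub> r \<in> S"
      using mult[of r p] by (simp_all add: mult.commute)
  qed
qed

lemma poly_ring_ideal:
  fixes S :: "'a::field mpol set"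
  assumes "ideal S (poly_ring n)"
  shows poly_ring_ideal_carrier: "p \<in> S \<Longrightarrow> p \<in> carrier (poly_ring n)"
    and poly_ring_ideal_zero: "0 \<in> S"
    and poly_ring_ideal_add: "p \<in> S \<Longrightarrow> q \<in> S \<Longrightarrow> p + q \<in> S"
    and poly_ring_ideal_mult: "r \<in> carrier (poly_ring n) \<Longrightarrow> p \<in> S \<Longrightarrow> r * p \<in> S"
    and poly_ring_ideal_diff: "p \<in> S \<Longrightarrow> q \<in> S \<Longrightarrow> p - q \<in> S"
proof -
  interpret S: ideal S "poly_ring n" by fact
  show "p \<in> carrier (poly_ring n)" if "p \<in> S" using that by (rule S.Icarr)
  show "0 \<in> S" using additive_subgroup.zero_closed[OF ideal.axioms(1)[OF assms]] by simp
  show add: "p + q \<in> S" if "p \<in> S" "q \<in> S" for p q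
    using additive_subgroup.a_closed[OF ideal.axioms(1)[OF assms] that] by simp
  show mult: "r * p \<in> S" if "r \<in> carrier (poly_ring n)" "p \<in> S" for r p
    using S.I_l_closed[OF that(2,1)] by simp
  show "p - q \<in> S" if "p \<in> S" "q \<in> S"
    using add[OF that(1) mult[OF _ that(2), of "- 1"]] by (simp add: in_poly_ring_iff)
qed

lemma poly_ring_ideal_sum:
  fixes S :: "'a::field mpol set"
  assumes "ideal S (poly_ring n)" "\<And>x. x \<in> A \<Longrightarrow> f x \<in> S"
  shows "sum f A \<in> S"
  using assms(2)
  by (induction A rule: infinite_finite_induct)
    (auto intro: poly_ring_ideal_zero[OF assms(1)] poly_ring_ideal_add[OF assms(1)])

lemma monomial_in_poly_ring [simp]: "monomial m \<in> carrier (poly_ring n) \<longleftrightarrow> m \<in> monomials n"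
  by (simp add: in_poly_ring_iff)

lemma const_in_poly_ring [simp]: "const c \<in> carrier (poly_ring n)"
  using support_const[of c] by (auto simp: in_poly_ring_iff)

lemma leading_mon:
  fixes p :: "'a::field mpol"
  assumes "p \<noteq> 0"
  shows leading_mon_in_support: "leading_mon p \<in> support p"
    and leading_mon_greatest:
      "m \<in> support p \<Longrightarrow> m \<noteq> leading_mon p \<Longrightarrow> grevlex_less m (leading_mon p)"
  using theI'[OF leading_mon_unique[OF assms]] unfolding leading_mon_def by blast+

lemma leading_monI:
  fixes p :: "'a::field mpol"
  assumes "m \<in> support p" "\<And>m'. m' \<in> support p \<Longrightarrow> m' \<noteq> m \<Longrightarrow> grevlex_less m' m"
  shows "leading_mon p = m"
proof -
  have "p \<noteq> 0" using assms(1) by auto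
  from leading_mon_unique[OF this] show ?thesis
    unfolding leading_mon_def by (rule the1_equality) (use assms in blast)
qed

section \<open>Monomial ideals and their Hilbert functions\<close>

text \<open>
  If $B$ is closed under divisors, then multiples of monomials outside $B$ stay outside $B$.
\<close>

lemma ideal_nonstandard:
  assumes divisor_closed: "\<And>a b. a + b \<in> B \<Longrightarrow> b \<in> B"
  shows "ideal {p \<in> carrier (poly_ring n). support p \<inter> B = {}} (poly_ring n :: 'a::field mpol ring)"
    (is "ideal ?T _")
proof (rule ideal_poly_ringI)
  fix p q :: "'a mpol" assume "p \<in> ?T" "q \<in> ?T"
  then show "p + q \<in> ?T" using keys_add[of p q] by (auto simp: in_poly_ring_iff)
next
  fix r p :: "'a mpol" assume r: "r \<in> carrier (poly_ring n)" and p: "p \<in> ?T"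
  then show "r * p \<in> ?T"
    using poly_ring_carrier_times[OF r, of p] subsetD[OF keys_mult[of r p]] divisor_closed
    by fastforce
qed (auto simp: in_poly_ring_iff)

text \<open>
  The criterion by which a guess \<open>B\<close> for the standard monomials is verified. The hypothesis
  \<open>leading\<close> keeps the generators of the initial ideal off \<open>B\<close>, and \<open>divisible\<close> puts every
  monomial off \<open>B\<close> into the initial ideal.
\<close>

lemma initial_ideal_eq:
  fixes I :: "'a::field mpol set"
  assumes I: "ideal I (poly_ring n)"
    and divisor_closed: "\<And>a b. a + b \<in> B \<Longrightarrow> b \<in> B"
    and leading: "\<And>p. p \<in> I \<Longrightarrow> p \<noteq> 0 \<Longrightarrow> leading_mon p \<notin> B"
    and divisible: "\<And>m. m \<in> monomials n \<Longrightarrow> m \<notin> B \<Longrightarrow>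
                      \<exists>p\<in>I. \<exists>a. p \<noteq> 0 \<and> m = a + leading_mon p"
  shows "initial_ideal n I = {p \<in> carrier (poly_ring n). support p \<inter> B = {}}" (is "?J = ?T")
proof -
  interpret R: cring "poly_ring n :: 'a mpol ring" by (rule cring_poly_ring)
  let ?G = "(\<lambda>p. monomial (leading_mon p)) ` (I - {0}) :: 'a mpol set"
  have lead_mon: "leading_mon p \<in> monomials n" if "p \<in> I" "p \<noteq> 0" for p
    using poly_ring_ideal_carrier[OF I that(1)] leading_mon_in_support[OF that(2)]
    by (meson in_poly_ring_iff subsetD)
  then have G: "?G \<subseteq> carrier (poly_ring n)" by (auto intro: lead_mon)
  have J: "ideal ?J (poly_ring n)"
    unfolding initial_ideal_def by (rule R.genideal_ideal[OF G])
  have "ideal ?T (poly_ring n)"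
    by (rule ideal_nonstandard) (rule divisor_closed)
  moreover have "?G \<subseteq> ?T" using leading by (auto intro: lead_mon)
  ultimately have "?J \<subseteq> ?T"
    unfolding initial_ideal_def by (rule R.genideal_minimal)
  moreover have "?T \<subseteq> ?J"
  proof
    fix p assume p: "p \<in> ?T"
    have "Poly_Mapping.single m (coefficient p m) \<in> ?J" if m: "m \<in> support p" for m
    proof -
      have "m \<in> monomials n" "m \<notin> B" using p m by (auto simp: in_poly_ring_iff)
      then obtain q a where q: "q \<in> I" "q \<noteq> 0" "m = a + leading_mon q"
        using divisible by blast
      have "monomial (leading_mon q) \<in> ?J"
        using R.genideal_self[OF G] q unfolding initial_ideal_def by blast
      moreover have "const (coefficient p m) * monomial a \<in> carrier (poly_ring n)"
        using poly_ring_carrier_times[of "const (coefficient p m)" n "monomial a"]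
          \<open>m \<in> monomials n\<close> q(3) by simp
      ultimately have "const (coefficient p m) * monomial a * monomial (leading_mon q) \<in> ?J"
        using poly_ring_ideal_mult[OF J] by blast
      then show ?thesis by (simp add: const_def monomial_def mult_single q(3))
    qed
    then show "p \<in> ?J"
      using poly_ring_ideal_sum[OF J, of "support p"] sum_of_terms[of p] by metis
  qed
  ultimately show ?thesis by blast
qed

lemma const_add: "const a + const b = const (a + b)"
  by (simp add: const_def single_add)

lemma const_mult: "const a * const b = const (a * b)"
  by (simp add: const_def mult_single)

lemma subfield_const: "subfield (range const) (poly_ring n :: 'a::field mpol ring)"
proof -
  interpret R: cring "poly_ring n :: 'a mpol ring" by (rule cring_poly_ring)
  let ?K = "range const :: 'a mpol set"
  have "subring ?K (poly_ring n)"
  proof (rule R.subringI)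
    show "\<one>\<^bsub>poly_ring n\<^esub> \<in> ?K"
      by (auto simp: const_def intro!: image_eqI[of _ _ 1])
    fix h assume "h \<in> ?K"
    then obtain c where h: "h = const c" by blast
    have "\<ominus>\<^bsub>poly_ring n\<^esub> h = const (- c)"
      by (rule R.minus_equality) (simp_all add: h const_add, simp add: const_def)
    then show "\<ominus>\<^bsub>poly_ring n\<^esub> h \<in> ?K" by simp
  qed (auto simp: const_add const_mult)
  then have "subcring ?K (poly_ring n)" by (rule R.subcringI')
  moreover have "Units (poly_ring n \<lparr>carrier := ?K\<rparr>) = ?K - {\<zero>\<^bsub>poly_ring n\<^esub>}"
  proof -
    have 1: "const 1 = (1 :: 'a mpol)" by (simp add: const_def)
    have "const c \<in> Units (poly_ring n \<lparr>carrier := ?K\<rparr>)" if "c \<noteq> 0" for c :: 'a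
      using that unfolding Units_def
      by (auto simp: const_mult 1[symmetric] intro!: exI[of _ "inverse c"])
    moreover have "const c \<noteq> 0 \<Longrightarrow> c \<noteq> 0" for c :: 'a by (auto simp: const_def)
    moreover have "0 \<notin> Units (poly_ring n \<lparr>carrier := ?K\<rparr>)" by (auto simp: Units_def)
    moreover have "Units (poly_ring n \<lparr>carrier := ?K\<rparr>) \<subseteq> ?K" by (auto simp: Units_def)
    ultimately show ?thesis by auto
  qed
  ultimately show ?thesis by (rule R.subfieldI)
qed

text \<open>
  The residue classes of the members of \<open>B\<close> of degree \<open>k\<close> are a basis of the \<open>k\<close>-th graded
  component: a form can be stripped of its terms outside \<open>B\<close> modulo \<open>J\<close>, and two polynomials
  supported in \<open>B\<close> that agree modulo \<open>J\<close> are equal because their difference has its support both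
  in \<open>B\<close> and outside it. The scalars are the image of the constants, which stay a field in the
  quotient because $1 \in B$ keeps \<open>J\<close> proper.
\<close>

lemma hilbert_function_eq_card:
  fixes J :: "'a::field mpol set"
  assumes J_eq: "J = {p \<in> carrier (poly_ring n). support p \<inter> B = {}}"
    and divisor_closed: "\<And>a b. a + b \<in> B \<Longrightarrow> b \<in> B"
    and B: "B \<subseteq> monomials n" "0 \<in> B"
    and fin: "finite {b \<in> B. mon_deg b = k}"
  shows "hilbert_function n J k = card {b \<in> B. mon_deg b = k}"
proof -
  define Q where "Q = poly_ring n Quot J"
  define h where "h = (\<lambda>p. J +>\<^bsub>poly_ring n\<^esub> p)"
  define K where "K = h ` range const"
  interpret R: cring "poly_ring n :: 'a mpol ring" by (rule cring_poly_ring)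
  have J: "ideal J (poly_ring n)"
    unfolding J_eq by (rule ideal_nonstandard) (rule divisor_closed)
  interpret J: ideal J "poly_ring n" by (rule J)
  interpret h: ring_hom_ring "poly_ring n" Q h
    using J.rcos_ring_hom_ring unfolding Q_def h_def by simp
  have carrier_iff: "p \<in> carrier (poly_ring n)" if "support p \<subseteq> B" for p :: "'a mpol"
    using that B(1) by (auto simp: in_poly_ring_iff)
  have h_eq_iff: "h p = h q \<longleftrightarrow> p - q \<in> J"
    if "p \<in> carrier (poly_ring n)" "q \<in> carrier (poly_ring n)" for p q
  proof -
    have "p \<ominus>\<^bsub>poly_ring n\<^esub> q = p - q"
    proof -
      have "\<ominus>\<^bsub>poly_ring n\<^esub> q = - q"
        by (rule R.minus_equality) (use that in \<open>auto simp: in_poly_ring_iff\<close>)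
      then show ?thesis by (simp add: R.minus_eq)
    qed
    then show ?thesis
      using R.quotient_eq_iff_same_a_r_cos[OF J that] by (simp add: h_def)
  qed
  have h_zero: "h 0 = \<zero>\<^bsub>Q\<^esub>" using h.hom_zero by simp
  have h_inj: "p = q" if "h p = h q" "support p \<subseteq> B" "support q \<subseteq> B" for p q
  proof -
    have "p - q \<in> J" using h_eq_iff that carrier_iff by blast
    moreover have "support (p - q) \<subseteq> B" using support_diff[of p q] that by blast
    ultimately have "support (p - q) = {}" unfolding J_eq by blast
    then show ?thesis by simp
  qed
  have "\<one>\<^bsub>Q\<^esub> \<noteq> \<zero>\<^bsub>Q\<^esub>"
    using h_inj[of 1 0] h.hom_one h_zero B(2) by auto
  then have K: "subfield K Q"
    unfolding K_def using h.img_is_subfield(2) subfield_const by blast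
  let ?v = "\<lambda>b. h (monomial b)"
  have Span: "h.S.Span K (map ?v bs) = h ` {p. support p \<subseteq> set bs}" if "set bs \<subseteq> B" for bs
    using that
  proof (induction bs)
    case Nil
    then show ?case by (simp add: h_zero)
  next
    case (Cons b bs)
    have b: "monomial b \<in> carrier (poly_ring n)" using Cons.prems B by auto
    have *: "h (const c) \<otimes>\<^bsub>Q\<^esub> ?v b \<oplus>\<^bsub>Q\<^esub> h p = h (Poly_Mapping.single b c + p)"
      if "support p \<subseteq> set bs" for c p
    proof -
      have p: "p \<in> carrier (poly_ring n)" using that Cons.prems by (intro carrier_iff) auto
      have s: "Poly_Mapping.single b c \<in> carrier (poly_ring n)"
        using b by (auto simp: in_poly_ring_iff)
      have "h (const c) \<otimes>\<^bsub>Q\<^esub> ?v b = h (Poly_Mapping.single b c)"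
        using h.hom_mult[OF _ b, of "const c"] by (simp add: const_mult_monomial)
      then show ?thesis using h.hom_add[OF s p] by simp
    qed
    have "h.S.Span K (map ?v (b # bs)) =
        {h (const c) \<otimes>\<^bsub>Q\<^esub> ?v b \<oplus>\<^bsub>Q\<^esub> h p | c p. support p \<subseteq> set bs}"
      using Cons by (auto simp: h.S.line_extension_mem_iff K_def) blast+
    also have "\<dots> = {h (Poly_Mapping.single b c + p) | c p. support p \<subseteq> set bs}"
      using * by (intro Collect_cong) metis
    also have "\<dots> = h ` {p. support p \<subseteq> set (b # bs)}"
    proof (intro equalityI subsetI)
      fix x assume "x \<in> {h (Poly_Mapping.single b c + p) | c p. support p \<subseteq> set bs}"
      then obtain c p where x: "x = h (Poly_Mapping.single b c + p)" "support p \<subseteq> set bs" by blast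
      then have "support (Poly_Mapping.single b c + p) \<subseteq> set (b # bs)"
        using keys_add[of "Poly_Mapping.single b c" p] by (auto split: if_splits)
      then show "x \<in> h ` {p. support p \<subseteq> set (b # bs)}" using x by blast
    next
      fix x assume "x \<in> h ` {p. support p \<subseteq> set (b # bs)}"
      then obtain p where p: "x = h p" "support p \<subseteq> set (b # bs)" by blast
      let ?q = "p - Poly_Mapping.single b (coefficient p b)"
      have "support ?q \<subseteq> set bs"
        using p(2) by (auto simp: in_keys_iff lookup_minus lookup_single when_def split: if_splits)
      moreover have "x = h (Poly_Mapping.single b (coefficient p b) + ?q)" by (simp add: p)
      ultimately show "x \<in> {h (Poly_Mapping.single b c + p) | c p. support p \<subseteq> set bs}" by blast
    qed
    finally show ?case .
  qed
  have independent: "h.S.independent K (map ?v bs)" if "set bs \<subseteq> B" "distinct bs" for bs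
    using that
  proof (induction bs)
    case (Cons b bs)
    have "?v b \<notin> h ` {p. support p \<subseteq> set bs}"
    proof
      assume "?v b \<in> h ` {p. support p \<subseteq> set bs}"
      then obtain p where p: "?v b = h p" "support p \<subseteq> set bs" by blast
      then have "monomial b = p" using Cons.prems by (intro h_inj) auto
      then show False using p(2) Cons.prems by auto
    qed
    moreover have "?v b \<in> carrier Q" using Cons.prems B by (intro h.hom_closed) auto
    ultimately show ?case
      using Cons Span[of bs] by (auto intro!: h.S.independent.li_Cons)
  qed simp
  define Bk where "Bk = {b \<in> B. mon_deg b = k}"
  obtain bs where bs: "set bs = Bk" "distinct bs"
    using finite_distinct_list[OF fin[folded Bk_def]] by blast
  have "h ` homogeneous_part n k = h ` {p. support p \<subseteq> Bk}"
  proof (intro equalityI subsetI)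
    fix x assume "x \<in> h ` homogeneous_part n k"
    then obtain p where x: "x = h p" and p: "p \<in> carrier (poly_ring n)"
      "\<And>m. m \<in> support p \<Longrightarrow> mon_deg m = k" by (auto simp: homogeneous_part_def)
    \<comment> \<open>the part of \<open>p\<close> supported in \<open>B\<close>\<close>
    define q where "q = (\<Sum>m\<in>support p \<inter> B. Poly_Mapping.single m (coefficient p m))"
    have q: "coefficient q m = (if m \<in> B then coefficient p m else 0)" for m
      by (simp add: q_def lookup_sum lookup_single when_def sum.delta' in_keys_iff)
    have "support q \<subseteq> Bk" using p(2) by (auto simp: in_keys_iff q Bk_def split: if_splits)
    moreover have "h p = h q"
    proof -
      have "q \<in> carrier (poly_ring n)" using \<open>support q \<subseteq> Bk\<close> by (intro carrier_iff) (auto simp: Bk_def)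
      moreover have "p - q \<in> J"
        using p(1) by (auto simp: J_eq in_poly_ring_iff in_keys_iff lookup_minus q split: if_splits)
      ultimately show ?thesis using h_eq_iff p(1) by blast
    qed
    ultimately show "x \<in> h ` {p. support p \<subseteq> Bk}" using x by blast
  next
    fix x assume "x \<in> h ` {p. support p \<subseteq> Bk}"
    then show "x \<in> h ` homogeneous_part n k"
      by (auto simp: homogeneous_part_def Bk_def intro!: imageI carrier_iff)
  qed
  then have "h.S.Span K (map ?v bs) = h ` homogeneous_part n k"
    using Span[of bs] bs by (simp add: Bk_def)
  then have "h.S.dimension (length (map ?v bs)) K (h ` homogeneous_part n k)"
    using independent[of bs] bs by (intro h.S.dimensionI[OF K]) (auto simp: Bk_def)
  then have "h.S.dim K (h ` homogeneous_part n k) = length (map ?v bs)"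
    using h.S.dimI[OF K] by (simp add: over_def)
  then show ?thesis
    using bs distinct_card[OF bs(2)]
    by (simp add: hilbert_function_def Q_def h_def K_def Bk_def)
qed

section \<open>Coefficient sums vanishing on an ideal\<close>

definition coeff_sum :: "mon set \<Rightarrow> 'a::field mpol \<Rightarrow> 'a" where
  "coeff_sum C p = (\<Sum>m\<in>support p. if m \<in> C then coefficient p m else 0)"

lemma coeff_sum_zero [simp]: "coeff_sum C 0 = 0"
  by (simp add: coeff_sum_def)

lemma coeff_sum_add: "coeff_sum C (p + q) = coeff_sum C p + coeff_sum C q"
  unfolding coeff_sum_def
  using setsum_keys_plus_distrib[of "\<lambda>m x. if m \<in> C then x else 0" p q] by simp

lemma coeff_sum_single [simp]: "coeff_sum C (Poly_Mapping.single m c) = (if m \<in> C then c else 0)"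
  by (simp add: coeff_sum_def)

lemma coeff_sum_monomial [simp]: "coeff_sum C (monomial m) = (if m \<in> C then 1 else 0)"
  by (simp add: monomial_def)

lemma coeff_sum_diff: "coeff_sum C (p - q) = coeff_sum C p - coeff_sum C q"
  using coeff_sum_add[of C "p - q" q] by simp

lemma coeff_sum_sum: "coeff_sum C (sum f A) = (\<Sum>x\<in>A. coeff_sum C (f x))"
  by (induction A rule: infinite_finite_induct) (simp_all add: coeff_sum_add)

lemma coeff_sum_mult:
  "coeff_sum C (r * p) = (\<Sum>a\<in>support r. coefficient r a * coeff_sum {m. a + m \<in> C} p)"
proof -
  have "r * p = (\<Sum>a\<in>support r. \<Sum>m\<in>support p.
      Poly_Mapping.single (a + m) (coefficient r a * coefficient p m))"
    using sum_product[of "\<lambda>a. Poly_Mapping.single a (coefficient r a)" "support r"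
        "\<lambda>m. Poly_Mapping.single m (coefficient p m)" "support p"]
    by (simp add: sum_of_terms mult_single)
  then show ?thesis
    by (auto simp: coeff_sum_sum coeff_sum_def[of _ p] sum_distrib_left intro!: sum.cong)
qed

text \<open>
  Multiplying a polynomial by a monomial \<open>a\<close> turns its coefficient sum over \<open>C\<close> into the one over
  the preimage of \<open>C\<close> under translation by \<open>a\<close>. So a family of sets closed under these preimages
  only has to be tested on the generators.
\<close>

lemma coeff_sum_ideal:
  fixes S :: "'a::field mpol set"
  assumes S: "S \<subseteq> carrier (poly_ring n)"
    and translate: "\<And>C a. C \<in> \<C> \<Longrightarrow> {m. a + m \<in> C} \<in> \<C>"
    and generators: "\<And>C g. C \<in> \<C> \<Longrightarrow> g \<in> S \<Longrightarrow> coeff_sum C g = 0"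
    and "p \<in> Idl\<^bsub>poly_ring n\<^esub> S" "C \<in> \<C>"
  shows "coeff_sum C p = 0"
proof -
  interpret R: cring "poly_ring n :: 'a mpol ring" by (rule cring_poly_ring)
  let ?T = "{p \<in> carrier (poly_ring n). \<forall>C\<in>\<C>. coeff_sum C p = 0} :: 'a mpol set"
  have "ideal ?T (poly_ring n)"
  proof (rule ideal_poly_ringI)
    fix p q :: "'a mpol" assume "p \<in> ?T" "q \<in> ?T"
    then show "p + q \<in> ?T" using R.a_closed[of p q] by (simp add: coeff_sum_add)
  next
    fix r p :: "'a mpol" assume "r \<in> carrier (poly_ring n)" "p \<in> ?T"
    then show "r * p \<in> ?T"
      using poly_ring_carrier_times[of r n p] by (simp add: coeff_sum_mult translate)
  qed (auto simp: in_poly_ring_iff)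
  moreover have "S \<subseteq> ?T" using S generators by auto
  ultimately have "Idl\<^bsub>poly_ring n\<^esub> S \<subseteq> ?T" by (rule R.genideal_minimal)
  then show ?thesis using assms(4,5) by blast
qed

section \<open>Degrees and squarefree monomials\<close>

lemma mon_deg_superset:
  assumes "finite A" "Poly_Mapping.keys m \<subseteq> A"
  shows "mon_deg m = (\<Sum>i\<in>A. exponent m i)"
  unfolding mon_deg_def by (rule sum.mono_neutral_left) (use assms in \<open>auto simp: in_keys_iff\<close>)

lemma mon_deg_add [simp]: "mon_deg (a + b) = mon_deg a + mon_deg b"
  unfolding mon_deg_def using setsum_keys_plus_distrib[of "\<lambda>m x. x" a b] by simp

lemma mon_deg_single [simp]: "mon_deg (Poly_Mapping.single i k) = k"
  by (simp add: mon_deg_def)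

lemma mon_deg_zero [simp]: "mon_deg 0 = 0"
  by (simp add: mon_deg_def)

lemma mon_deg_sum [simp]: "mon_deg (sum f A) = (\<Sum>x\<in>A. mon_deg (f x))"
  by (induction A rule: infinite_finite_induct) simp_all

definition squarefree_mon :: "nat set \<Rightarrow> mon" where
  "squarefree_mon A = (\<Sum>i\<in>A. Poly_Mapping.single i 1)"

lemma squarefree_mon_remove:
  "finite A \<Longrightarrow> i \<in> A \<Longrightarrow>
     squarefree_mon A = Poly_Mapping.single i 1 + squarefree_mon (A - {i})"
  unfolding squarefree_mon_def by (rule sum.remove)

lemma exponent_squarefree_mon [simp]:
  "finite A \<Longrightarrow> exponent (squarefree_mon A) i = (if i \<in> A then 1 else 0)"
  by (simp add: squarefree_mon_def lookup_sum lookup_single when_def)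

lemma mon_deg_squarefree_mon [simp]: "mon_deg (squarefree_mon A) = card A"
  by (simp add: squarefree_mon_def)

lemma prod_var: "(\<Prod>j\<in>A. var j) = monomial (squarefree_mon A)"
  by (induction A rule: infinite_finite_induct)
    (simp_all add: squarefree_mon_def monomial_zero var_def monomial_mult)

lemma mon_deg_monomials:
  assumes "m \<in> monomials n" "n \<ge> 1"
  shows "mon_deg m = (\<Sum>i\<in>{1..<n}. exponent m i) + exponent m n"
proof -
  have "{1..n} = insert n {1..<n}" using assms(2) by auto
  then show ?thesis
    using mon_deg_superset[of "{1..n}" m] assms(1) by (simp add: monomials_def)
qed

lemma divides_monI:
  fixes u m :: mon
  assumes "\<And>i. exponent u i \<le> exponent m i"
  shows "m = (m - u) + u"
  by (rule poly_mapping_eqI) (use assms in \<open>simp add: lookup_add lookup_minus\<close>)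

section \<open>Standard monomials\<close>

definition standard :: "nat \<Rightarrow> mon set" where
  "standard n = {m \<in> monomials n. (\<forall>i\<in>{1..<n}. exponent m i \<le> 1) \<and>
     2 * (\<Sum>i\<in>{1..<n}. exponent m i) + exponent m n \<le> 2 * n - 4}"

lemma standard_divisor_closed:
  assumes "a + b \<in> standard n"
  shows "b \<in> standard n"
proof -
  have le: "exponent b i \<le> exponent (a + b) i" for i by (simp add: lookup_add)
  have "exponent b i \<le> 1" if "i \<in> {1..<n}" for i
    using le[of i] assms that by (force simp: standard_def)
  moreover have "(\<Sum>i\<in>{1..<n}. exponent b i) \<le> (\<Sum>i\<in>{1..<n}. exponent (a + b) i)"
    by (rule sum_mono) (rule le)
  ultimately show ?thesis using assms le[of n] by (simp add: standard_def)
qed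

lemma zero_standard [simp]: "0 \<in> standard n"
  by (simp add: standard_def)

text \<open>
  Apart from isolating the monomial $1$, this is congruence of exponent vectors modulo the lattice
  spanned by the vectors $(1,\dots,1) - 2e_i$: in $\sum_i c_i ((1,\dots,1) - 2e_i)$ with
  $k = \sum_i c_i$ the $i$-th entry is $k - 2c_i$ and the entries sum to $(n-2)k$; conversely,
  these two conditions determine integers $c_i$ with sum $k$.
\<close>

definition linked :: "nat \<Rightarrow> mon \<Rightarrow> mon \<Rightarrow> bool" where
  "linked n a b \<longleftrightarrow> (a = 0 \<longleftrightarrow> b = 0) \<and>
     (\<exists>k::int. (\<forall>i\<in>{1..n}. even (int (exponent b i) - int (exponent a i) - k)) \<and>
        (\<Sum>i=1..n. int (exponent b i) - int (exponent a i)) = (int n - 2) * k)"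

lemma linked_refl: "linked n a a"
  unfolding linked_def by (auto intro!: exI[of _ 0])

lemma linked_sym: "linked n a b \<Longrightarrow> linked n b a"
proof -
  assume "linked n a b"
  then obtain k :: int where k: "a = 0 \<longleftrightarrow> b = 0"
    "\<forall>i\<in>{1..n}. even (int (exponent b i) - int (exponent a i) - k)"
    "(\<Sum>i=1..n. int (exponent b i) - int (exponent a i)) = (int n - 2) * k"
    unfolding linked_def by blast
  have "\<forall>i\<in>{1..n}. even (int (exponent a i) - int (exponent b i) - (- k))"
    using k(2) by auto
  moreover have "(\<Sum>i=1..n. int (exponent a i) - int (exponent b i)) = (int n - 2) * (- k)"
    using k(3) by (simp add: sum_subtractf)
  ultimately show ?thesis unfolding linked_def using k(1) by blast
qed

lemma linked_trans: "linked n a b \<Longrightarrow> linked n b c \<Longrightarrow> linked n a c"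
proof -
  assume "linked n a b" "linked n b c"
  then obtain k l :: int where k: "a = 0 \<longleftrightarrow> b = 0"
    "\<forall>i\<in>{1..n}. even (int (exponent b i) - int (exponent a i) - k)"
    "(\<Sum>i=1..n. int (exponent b i) - int (exponent a i)) = (int n - 2) * k"
    and l: "b = 0 \<longleftrightarrow> c = 0"
    "\<forall>i\<in>{1..n}. even (int (exponent c i) - int (exponent b i) - l)"
    "(\<Sum>i=1..n. int (exponent c i) - int (exponent b i)) = (int n - 2) * l"
    unfolding linked_def by blast
  have "\<forall>i\<in>{1..n}. even (int (exponent c i) - int (exponent a i) - (k + l))"
    using k(2) l(2) by auto
  moreover have "(\<Sum>i=1..n. int (exponent c i) - int (exponent a i)) = (int n - 2) * (k + l)"
    using k(3) l(3) by (simp add: sum_subtractf algebra_simps)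
  ultimately show ?thesis unfolding linked_def using k(1) l(1) by blast
qed

lemma mon_add_eq_zero_iff: "a + b = 0 \<longleftrightarrow> a = 0 \<and> (b :: mon) = 0"
  by (auto simp: poly_mapping_eq_iff fun_eq_iff lookup_add)

lemma linked_add: "linked n a b \<Longrightarrow> linked n (c + a) (c + b)"
  unfolding linked_def by (auto simp: lookup_add mon_add_eq_zero_iff)

text \<open>
  Let $k$ be the integer that witnesses the link, so that
  $\deg m - \deg b = (n-2)k$. For $k > 0$ the degrees decide. For $k = 0$ parity and
  $b_i \le 1$ give $m_i \ge b_i$ for $i < n$, so $b$ has the larger last exponent. A negative $k$
  is excluded by the bound that defines standard monomials: if $k$ is odd, then
  $m_i \ge 1 - b_i$ for $i < n$, and if $k \le -2$ is even, then $m_i \ge b_i$ forces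
  $b = x_n^{2n-4}$ and $m = 1$, which are not linked.
\<close>

lemma standard_least_linked:
  assumes n: "n \<ge> 3" and b: "b \<in> standard n" and m: "m \<in> monomials n"
    and linked: "linked n b m" and "m \<noteq> b"
  shows "grevlex_less b m"
proof -
  obtain k :: int where zero: "b = 0 \<longleftrightarrow> m = 0"
    and parity: "\<And>i. i \<in> {1..n} \<Longrightarrow> even (int (exponent m i) - int (exponent b i) - k)"
    and "(\<Sum>i=1..n. int (exponent m i) - int (exponent b i)) = (int n - 2) * k"
    using linked unfolding linked_def by blast
  moreover have "{1..n} = insert n {1..<n}" using n by auto
  ultimately have deg_eq: "int (\<Sum>i\<in>{1..<n}. exponent m i) + int (exponent m n) =
      int (\<Sum>i\<in>{1..<n}. exponent b i) + int (exponent b n) + (int n - 2) * k"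
    by (simp add: sum_subtractf algebra_simps)
  have b_mon: "b \<in> monomials n" and b_le: "\<And>i. i \<in> {1..<n} \<Longrightarrow> exponent b i \<le> 1"
    and b_bound: "2 * (\<Sum>i\<in>{1..<n}. exponent b i) + exponent b n \<le> 2 * n - 4"
    using b by (auto simp: standard_def)
  define sm sb where sm_def: "sm = (\<Sum>i\<in>{1..<n}. exponent m i)"
    and sb_def: "sb = (\<Sum>i\<in>{1..<n}. exponent b i)"
  have bound: "2 * sb + exponent b n + 4 \<le> 2 * n" using b_bound n by (simp add: sb_def)
  have nonzero: "b \<noteq> 0" "m \<noteq> 0" using zero assms(5) by auto
  have deg_b: "mon_deg b = (\<Sum>i\<in>{1..<n}. exponent b i) + exponent b n"
    and deg_m: "mon_deg m = (\<Sum>i\<in>{1..<n}. exponent m i) + exponent m n"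
    using mon_deg_monomials b_mon m n by auto
  have even_k: "exponent b i \<le> exponent m i" if "even k" "i \<in> {1..<n}" for i
    using parity[of i] b_le[OF that(2)] that by (cases "exponent m i = 0") auto
  have odd_k: "1 - exponent b i \<le> exponent m i" if "odd k" "i \<in> {1..<n}" for i
    using parity[of i] that by (cases "exponent m i = 0") (auto dest: odd_pos)
  consider "k > 0" | "k = 0" | "k < 0" "odd k" | "k < 0" "even k" by linarith
  then show ?thesis
  proof cases
    case 1
    then have "(int n - 2) * k > 0" using n by simp
    then have "mon_deg b < mon_deg m" using deg_eq deg_b deg_m by linarith
    then show ?thesis by (simp add: grevlex_less_def)
  next
    case 2
    have deg: "(\<Sum>i\<in>{1..<n}. exponent m i) + exponent m n =
        (\<Sum>i\<in>{1..<n}. exponent b i) + exponent b n"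
      using deg_eq unfolding 2 by linarith
    \<comment> \<open>As $m_i \ge b_i$ for $i < n$, equal last exponents would make all exponents equal.\<close>
    have "exponent m n \<noteq> exponent b n"
    proof
      assume eq: "exponent m n = exponent b n"
      have "exponent m i = exponent b i" for i
      proof (cases "i \<in> {1..<n}")
        case True
        have "(\<Sum>i\<in>{1..<n}. exponent b i) = (\<Sum>i\<in>{1..<n}. exponent m i)"
          using deg eq by simp
        then show ?thesis
          using sum_mono_inv[of "exponent b" "{1..<n}" "exponent m" i] even_k 2 True by simp
      next
        case False
        then show ?thesis
          using eq b_mon m by (cases "i = n") (auto simp: in_monomials_iff)
      qed
      then have "m = b" by (intro poly_mapping_eqI)
      then show False using \<open>m \<noteq> b\<close> by simp
    qed
    moreover have "(\<Sum>i\<in>{1..<n}. exponent b i) \<le> (\<Sum>i\<in>{1..<n}. exponent m i)"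
      using even_k 2 by (intro sum_mono) simp
    ultimately have "exponent m n < exponent b n" using deg by linarith
    moreover have "\<forall>j>n. exponent b j = exponent m j"
      using b_mon m by (simp add: in_monomials_iff)
    ultimately show ?thesis
      using deg deg_b deg_m by (auto simp: grevlex_less_def)
  next
    case 3
    have "(\<Sum>i\<in>{1..<n}. 1) \<le> (\<Sum>i\<in>{1..<n}. exponent b i + exponent m i)"
      using odd_k 3 by (intro sum_mono) force
    then have "n \<le> sb + sm + 1"
      by (simp add: sum.distrib sb_def sm_def)
    moreover have "(int n - 2) * k \<le> 2 - int n"
      using mult_left_mono[of k "- 1" "int n - 2"] 3 n by simp
    ultimately have False
      using deg_eq bound unfolding sm_def[symmetric] sb_def[symmetric] by linarith
    then show ?thesis ..
  next
    case 4
    have "k \<le> - 2" using 4 by presburger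
    then have "(int n - 2) * k \<le> 4 - 2 * int n"
      using mult_left_mono[of k "- 2" "int n - 2"] n by simp
    moreover have "(\<Sum>i\<in>{1..<n}. exponent b i) \<le> (\<Sum>i\<in>{1..<n}. exponent m i)"
      using even_k 4 by (intro sum_mono) simp
    ultimately have "mon_deg m = 0"
      using deg_eq bound deg_m unfolding sm_def[symmetric] sb_def[symmetric] by linarith
    then have "\<forall>i\<in>Poly_Mapping.keys m. exponent m i = 0" by (simp add: mon_deg_def)
    then have "m = 0" using in_keys_iff by (metis keys_eq_empty all_not_in_conv)
    then show ?thesis using nonzero by simp
  qed
qed

section \<open>The binomial ideal for at least three variables\<close>

definition congruent :: "'a::field mpol set \<Rightarrow> mon \<Rightarrow> mon \<Rightarrow> bool" where
  "congruent I u v \<longleftrightarrow> monomial u - monomial v \<in> I"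

context
  fixes I :: "'a::field mpol set" and n :: nat
  assumes I: "ideal I (poly_ring n)"
begin

lemma congruent_refl: "congruent I u u"
  by (simp add: congruent_def poly_ring_ideal_zero[OF I])

lemma congruent_sym: "congruent I u v \<Longrightarrow> congruent I v u"
  using poly_ring_ideal_diff[OF I poly_ring_ideal_zero[OF I], of "monomial u - monomial v"]
  by (simp add: congruent_def)

lemma congruent_trans [trans]: "congruent I u v \<Longrightarrow> congruent I v w \<Longrightarrow> congruent I u w"
  using poly_ring_ideal_add[OF I, of "monomial u - monomial v" "monomial v - monomial w"]
  by (simp add: congruent_def)

lemma congruent_add:
  "congruent I u v \<Longrightarrow> a \<in> monomials n \<Longrightarrow> congruent I (a + u) (a + v)"
  using poly_ring_ideal_mult[OF I, of "monomial a" "monomial u - monomial v"]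
  by (simp add: congruent_def right_diff_distrib monomial_mult)

end

lemma leading_mon_binomial:
  assumes "grevlex_less v u"
  shows "leading_mon (monomial u - monomial v :: 'a::field mpol) = u"
    and "monomial u - monomial v \<noteq> (0 :: 'a mpol)"
proof -
  let ?p = "monomial u - monomial v :: 'a mpol"
  have "u \<noteq> v" using assms grevlex_less_irrefl by auto
  then have u: "u \<in> support ?p"
    by (simp add: in_keys_iff lookup_minus coefficient_monomial)
  then show "?p \<noteq> 0" by auto
  show "leading_mon ?p = u"
    using u assms support_diff[of "monomial u" "monomial v :: 'a mpol"]
    by (intro leading_monI) auto
qed

lemma squarefree_in_monomials: "A \<subseteq> {1..n} \<Longrightarrow> squarefree_mon A \<in> monomials n"
  using finite_subset[of A "{1..n}"] by (auto simp: in_monomials_iff)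

context
  fixes n :: nat and I :: "'a::field mpol set"
  assumes n: "n \<ge> 3"
  defines "I \<equiv> ideal_I n"
begin

lemma generators_binomial:
  "(\<Prod>j\<in>{1..n} - {i}. var j) - var i =
     monomial (squarefree_mon ({1..n} - {i})) - monomial (Poly_Mapping.single i 1)"
  by (simp add: prod_var) (simp add: var_def)

lemma I_eq: "I = Idl\<^bsub>poly_ring n\<^esub> ((\<lambda>i. monomial (squarefree_mon ({1..n} - {i})) -
    monomial (Poly_Mapping.single i 1)) ` {1..n})"
  using n unfolding I_def ideal_I_def generators_binomial by simp

lemma generators_carrier: "((\<lambda>i. monomial (squarefree_mon ({1..n} - {i})) -
    monomial (Poly_Mapping.single i 1)) ` {1..n} :: 'a mpol set) \<subseteq> carrier (poly_ring n)"
proof clarify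
  fix i assume i: "i \<in> {1..n}"
  have "squarefree_mon ({1..n} - {i}) \<in> monomials n"
    by (rule squarefree_in_monomials) auto
  then show "(monomial (squarefree_mon ({1..n} - {i})) - monomial (Poly_Mapping.single i 1) :: 'a mpol)
      \<in> carrier (poly_ring n)"
    using i support_diff[of "monomial (squarefree_mon ({1..n} - {i}))"
        "monomial (Poly_Mapping.single i 1) :: 'a mpol"]
    by (auto simp: in_poly_ring_iff simp del: One_nat_def)
qed

lemma ideal_I: "ideal I (poly_ring n)"
  unfolding I_eq by (rule ring.genideal_ideal[OF ring_poly_ring generators_carrier])

lemma congruent_generator:
  assumes "i \<in> {1..n}"
  shows "congruent I (squarefree_mon ({1..n} - {i})) (Poly_Mapping.single i 1)"
  unfolding congruent_def I_eq
  using ring.genideal_self[OF ring_poly_ring generators_carrier] assms by blast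

lemma linked_generator:
  assumes "i \<in> {1..n}"
  shows "linked n (squarefree_mon ({1..n} - {i})) (Poly_Mapping.single i 1)"
proof -
  have "card ({1..n} - {i}) = n - 1" using assms by simp
  then have "mon_deg (squarefree_mon ({1..n} - {i})) \<noteq> 0"
    using n by (simp only: mon_deg_squarefree_mon)
  then have "squarefree_mon ({1..n} - {i}) \<noteq> 0" by (metis mon_deg_zero)
  moreover have "Poly_Mapping.single i (1::nat) \<noteq> 0"
    by (metis lookup_single_eq lookup_zero zero_neq_one)
  moreover have "(\<Sum>j=1..n. int (exponent (Poly_Mapping.single i 1) j) -
      int (exponent (squarefree_mon ({1..n} - {i})) j)) = (int n - 2) * (- 1)"
  proof -
    have "(\<Sum>j=1..n. int (exponent (Poly_Mapping.single i 1) j) -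
      int (exponent (squarefree_mon ({1..n} - {i})) j)) = (\<Sum>j=1..n. (if j = i then 2 else 0) - 1)"
      by (rule sum.cong) (auto simp: lookup_single)
    also have "\<dots> = (int n - 2) * (- 1)" using assms by (simp add: sum_subtractf)
    finally show ?thesis .
  qed
  moreover have "\<forall>j\<in>{1..n}. even (int (exponent (Poly_Mapping.single i 1) j) -
      int (exponent (squarefree_mon ({1..n} - {i})) j) - (- 1))"
    by (auto simp: lookup_single when_def)
  ultimately show ?thesis unfolding linked_def by blast
qed

text \<open>
  Sets saturated under \<open>linked\<close> form a family as required by \<open>coeff_sum_ideal\<close>. In the class of a
  standard leading monomial no other monomial of the support could occur, as it would be larger;
  the sum over this class is then the leading coefficient, which is not zero.
\<close>

lemma leading_mon_not_standard:
  assumes p: "p \<in> I" "p \<noteq> 0"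
  shows "leading_mon p \<notin> standard n"
proof
  let ?b = "leading_mon p"
  let ?C = "{m. linked n ?b m}"
  let ?\<C> = "{C. \<forall>u v. linked n u v \<longrightarrow> (u \<in> C \<longleftrightarrow> v \<in> C)}"
  assume b: "?b \<in> standard n"
  have "?C \<in> ?\<C>" using linked_sym linked_trans by blast
  have "coeff_sum ?C p = 0"
  proof (rule coeff_sum_ideal[OF generators_carrier, where \<C> = ?\<C>])
    show "p \<in> Idl\<^bsub>poly_ring n\<^esub> ((\<lambda>i. monomial (squarefree_mon ({1..n} - {i})) -
        monomial (Poly_Mapping.single i 1)) ` {1..n})" using p(1) I_eq by simp
    show "?C \<in> ?\<C>" by fact
    show "{m. a + m \<in> C} \<in> ?\<C>" if "C \<in> ?\<C>" for C a
      using that linked_add by blast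
    fix C and g :: "'a mpol"
    assume C: "C \<in> ?\<C>" and "g \<in> (\<lambda>i. monomial (squarefree_mon ({1..n} - {i})) -
        monomial (Poly_Mapping.single i 1)) ` {1..n}"
    then obtain i where "i \<in> {1..n}"
      and g: "g = monomial (squarefree_mon ({1..n} - {i})) - monomial (Poly_Mapping.single i 1)"
      by blast
    then have "squarefree_mon ({1..n} - {i}) \<in> C \<longleftrightarrow> Poly_Mapping.single i 1 \<in> C"
      using C linked_generator by blast
    then show "coeff_sum C g = 0" by (simp add: g coeff_sum_diff)
  qed
  moreover have "coeff_sum ?C p = coefficient p ?b"
  proof -
    have "m \<notin> ?C" if m: "m \<in> support p" "m \<noteq> ?b" for m
    proof
      assume "m \<in> ?C"
      moreover have "m \<in> monomials n"
        using poly_ring_ideal_carrier[OF ideal_I p(1)] m(1) by (auto simp: in_poly_ring_iff)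
      ultimately have "grevlex_less ?b m"
        using standard_least_linked[OF n b] m(2) by blast
      then show False
        using leading_mon_greatest[OF p(2) m] grevlex_less_trans grevlex_less_irrefl by blast
    qed
    then have "coeff_sum ?C p = (\<Sum>m\<in>support p. if m = ?b then coefficient p m else 0)"
      unfolding coeff_sum_def by (intro sum.cong) (auto simp: linked_refl)
    then show ?thesis using leading_mon_in_support[OF p(2)] by simp
  qed
  ultimately show False using leading_mon_in_support[OF p(2)] by (simp add: in_keys_iff)
qed

text \<open>
  Both squares are congruent to $x_1 \cdots x_n$: multiply the \<open>i\<close>-th generator by $x_i$.
\<close>

lemma congruent_squares:
  assumes "i \<in> {1..n}" "j \<in> {1..n}"
  shows "congruent I (Poly_Mapping.single i 2) (Poly_Mapping.single j 2)"
proof -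
  have *: "congruent I (squarefree_mon {1..n}) (Poly_Mapping.single i 2)" if i: "i \<in> {1..n}" for i
  proof -
    have "Poly_Mapping.single i 1 + squarefree_mon ({1..n} - {i}) = squarefree_mon {1..n}"
      using squarefree_mon_remove[OF _ i] by simp
    moreover have "Poly_Mapping.single i 1 + Poly_Mapping.single i 1 = Poly_Mapping.single i (2::nat)"
      by (metis one_add_one single_add)
    ultimately show ?thesis
      using congruent_add[OF ideal_I congruent_generator[OF i], of "Poly_Mapping.single i 1"] i
      by simp
  qed
  show ?thesis
    using congruent_trans[OF ideal_I congruent_sym[OF ideal_I *[OF assms(1)]] *[OF assms(2)]] .
qed

lemma congruent_square_squarefree:
  assumes "A \<subseteq> {1..n}"
  shows "congruent I (squarefree_mon A + squarefree_mon A) (Poly_Mapping.single n (2 * card A))"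
  using finite_subset[OF assms finite_atLeastAtMost] assms
proof (induction A rule: finite_induct)
  case empty
  then show ?case by (simp add: squarefree_mon_def congruent_refl[OF ideal_I])
next
  case (insert i A)
  let ?e = "squarefree_mon A + squarefree_mon A"
  have i: "i \<in> {1..n}" "n \<in> {1..n}" using insert n by auto
  have e: "?e \<in> monomials n" using squarefree_in_monomials insert by simp
  have "squarefree_mon (insert i A) + squarefree_mon (insert i A) = ?e + Poly_Mapping.single i 2"
  proof -
    have "Poly_Mapping.single i 2 = Poly_Mapping.single i 1 + Poly_Mapping.single i (1::nat)"
      by (metis one_add_one single_add)
    then show ?thesis using insert by (simp add: squarefree_mon_def ac_simps)
  qed
  moreover have "congruent I (?e + Poly_Mapping.single i 2) (?e + Poly_Mapping.single n 2)"
    using congruent_add[OF ideal_I congruent_squares[OF i] e] .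
  moreover have "congruent I (Poly_Mapping.single n 2 + ?e)
      (Poly_Mapping.single n 2 + Poly_Mapping.single n (2 * card A))"
    using insert i by (intro congruent_add[OF ideal_I]) auto
  ultimately show ?case
    using congruent_trans[OF ideal_I] insert by (simp add: add.commute flip: single_add)
qed

text \<open>
  Choose $i \in T$ and multiply the generator $x_S\, x_{T - i}\, x_n - x_i$ by $x_{T-i}$; on the
  left side the square of $x_{T-i}$ becomes $x_n^{2(|T|-1)}$.
\<close>

lemma congruent_complement:
  assumes "T \<subseteq> {1..<n}" "T \<noteq> {}"
  shows "congruent I (squarefree_mon ({1..<n} - T) + Poly_Mapping.single n (2 * card T - 1))
           (squarefree_mon T)"
proof -
  obtain i where i: "i \<in> T" using assms(2) by blast
  let ?S = "{1..<n} - T" and ?T = "T - {i}"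
  have fin: "finite T" using assms(1) finite_subset by blast
  have iT: "i \<in> {1..n}" "?T \<subseteq> {1..n}" using i assms(1) by auto
  have "{1..n} - {i} = insert n (?S \<union> ?T)" using i assms(1) n by auto
  moreover have "n \<notin> ?S \<union> ?T" "?S \<inter> ?T = {}" using assms(1) by auto
  ultimately have split: "squarefree_mon ({1..n} - {i}) =
      squarefree_mon ?S + (squarefree_mon ?T + Poly_Mapping.single n 1)"
    using fin by (simp add: squarefree_mon_def sum.union_disjoint ac_simps)
  have T: "squarefree_mon ?T + Poly_Mapping.single i 1 = squarefree_mon T"
    using squarefree_mon_remove[OF fin i] by (simp add: add.commute)
  have "2 * card T - 1 = 1 + 2 * card ?T"
    using i fin card_Suc_Diff1[of T i] by simp
  then have "squarefree_mon ?S + Poly_Mapping.single n (2 * card T - 1) =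
      (squarefree_mon ?S + Poly_Mapping.single n 1) + Poly_Mapping.single n (2 * card ?T)"
    by (simp only: single_add add.assoc)
  moreover have "congruent I
      ((squarefree_mon ?S + Poly_Mapping.single n 1) + Poly_Mapping.single n (2 * card ?T))
      ((squarefree_mon ?S + Poly_Mapping.single n 1) + (squarefree_mon ?T + squarefree_mon ?T))"
    using congruent_sym[OF ideal_I congruent_square_squarefree[OF iT(2)]] n
    by (intro congruent_add[OF ideal_I]) (auto intro!: squarefree_in_monomials)
  moreover have "\<dots> = squarefree_mon ?T + squarefree_mon ({1..n} - {i})"
    unfolding split by (simp add: ac_simps)
  moreover have "congruent I (squarefree_mon ?T + squarefree_mon ({1..n} - {i})) (squarefree_mon T)"
    using congruent_add[OF ideal_I congruent_generator[OF iT(1)], of "squarefree_mon ?T"]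
      squarefree_in_monomials[OF iT(2)] unfolding T by blast
  ultimately show ?thesis using congruent_trans[OF ideal_I] by metis
qed

text \<open>
  A monomial outside the standard ones either has a square $x_i^2$ with $i < n$ as a divisor, or it
  is $x_S x_n^e$ with $2|S| + e \ge 2n-3$. In the second case let $T$ be the complement of $S$, of
  size $t$. If $T$ is empty, then $x_S$ reduces to $x_n$, and otherwise
  $e \ge 2t - 1$, so that \<open>congruent_complement\<close> applies.
\<close>

lemma nonstandard_reducible:
  assumes m: "m \<in> monomials n" "m \<notin> standard n"
  shows "\<exists>a u v. m = a + u \<and> congruent I u v \<and> grevlex_less v u"
proof (cases "\<exists>i\<in>{1..<n}. exponent m i \<ge> 2")
  case True
  then obtain i where i: "i \<in> {1..<n}" "exponent m i \<ge> 2" by blast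
  have "m = (m - Poly_Mapping.single i 2) + Poly_Mapping.single i 2"
    using i(2) by (intro divides_monI) (auto simp: lookup_single when_def)
  moreover have "congruent I (Poly_Mapping.single i 2) (Poly_Mapping.single n 2)"
    using i n by (intro congruent_squares) auto
  moreover have "grevlex_less (Poly_Mapping.single n 2) (Poly_Mapping.single i 2)"
    using i by (auto simp: grevlex_less_def lookup_single when_def intro!: exI[of _ n])
  ultimately show ?thesis by blast
next
  case False
  then have le: "exponent m i \<le> 1" if "i \<in> {1..<n}" for i using that by force
  define S where "S = {i \<in> {1..<n}. exponent m i = 1}"
  let ?T = "{1..<n} - S"
  have S: "S \<subseteq> {1..<n}" "finite S" by (auto simp: S_def)
  then have S_eq: "{1..<n} - ?T = S" by blast
  have card: "card S + card ?T = n - 1"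
    using S card_Diff_subset[of S "{1..<n}"] card_mono[of "{1..<n}" S] by simp
  have "(\<Sum>i\<in>{1..<n}. exponent m i) = (\<Sum>i\<in>{1..<n}. if i \<in> S then 1 else 0)"
    using le by (intro sum.cong) (auto simp: S_def le_Suc_eq)
  also have "\<dots> = card S" using S by (simp add: sum.If_cases Int_absorb1)
  finally have big: "2 * card S + exponent m n > 2 * n - 4"
    using m le unfolding standard_def by fastforce
  show ?thesis
  proof (cases "?T = {}")
    case True
    then have S': "S = {1..<n}" using S by blast
    have "{1..n} - {n} = {1..<n}" by auto
    then have "congruent I (squarefree_mon S) (Poly_Mapping.single n 1)"
      using congruent_generator[of n] n S' by simp
    moreover have "m = (m - squarefree_mon S) + squarefree_mon S"
      using S by (intro divides_monI) (auto simp: S_def)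
    moreover have "mon_deg (Poly_Mapping.single n 1) < mon_deg (squarefree_mon S)"
      using n S' by simp
    then have "grevlex_less (Poly_Mapping.single n 1) (squarefree_mon S)"
      by (simp add: grevlex_less_def)
    ultimately show ?thesis by blast
  next
    case False
    let ?u = "squarefree_mon S + Poly_Mapping.single n (2 * card ?T - 1)"
    have "card ?T > 0" using False by (simp add: card_gt_0_iff)
    have "congruent I ?u (squarefree_mon ?T)"
      using congruent_complement[of ?T] False unfolding S_eq by blast
    moreover have "m = (m - ?u) + ?u"
    proof (rule divides_monI)
      fix i
      have "2 * card ?T - 1 \<le> exponent m n" using big card n by linarith
      then show "exponent ?u i \<le> exponent m i"
        using S by (cases "i = n") (auto simp: lookup_add lookup_single when_def S_def)
    qed
    moreover have "mon_deg (squarefree_mon ?T) < mon_deg ?u"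
      using card n \<open>card ?T > 0\<close> by simp
    then have "grevlex_less (squarefree_mon ?T) ?u" by (simp add: grevlex_less_def)
    ultimately show ?thesis by blast
  qed
qed

lemma initial_ideal_standard:
  "initial_ideal n I = {p \<in> carrier (poly_ring n). support p \<inter> standard n = {}}"
proof (rule initial_ideal_eq[OF ideal_I])
  fix m assume "m \<in> monomials n" "m \<notin> standard n"
  then obtain a u v where "m = a + u" "monomial u - monomial v \<in> I" "grevlex_less v u"
    using nonstandard_reducible unfolding congruent_def by blast
  then show "\<exists>p\<in>I. \<exists>a. p \<noteq> 0 \<and> m = a + leading_mon p"
    using leading_mon_binomial[of v u] by metis
qed (use standard_divisor_closed leading_mon_not_standard in auto)

end

section \<open>The convention for two variables\<close>

lemma standard_2: "standard 2 = {0}"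
proof (intro equalityI subsetI)
  fix m assume m: "m \<in> standard 2"
  have "{1..<2::nat} = {1}" by auto
  then have "exponent m 1 = 0" "exponent m 2 = 0" using m by (auto simp: standard_def)
  moreover have "exponent m i = 0" if "i \<noteq> 1" "i \<noteq> 2" for i
    using m that by (auto simp: standard_def in_monomials_iff)
  ultimately have "m = 0" by (intro poly_mapping_eqI) (metis lookup_zero)
  then show "m \<in> {0}" by simp
qed simp

lemma leading_mon_monomial: "leading_mon (monomial m) = m"
  by (rule leading_monI) auto

text \<open>
  Here the generators are monomials rather than binomials. The subsets of $\{1\}$ play the part of
  the saturated sets, and they show that elements of the ideal have no constant term.
\<close>

lemma initial_ideal_standard_2:
  "initial_ideal 2 (ideal_I 2 :: 'a::field mpol set) =
     {p \<in> carrier (poly_ring 2). support p \<inter> standard 2 = {}}"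
proof -
  let ?I = "ideal_I 2 :: 'a mpol set"
  have I_eq: "?I = Idl\<^bsub>poly_ring 2\<^esub> {var 1, var 2}" by (simp add: ideal_I_def)
  have var: "{var 1, var 2 :: 'a mpol} \<subseteq> carrier (poly_ring 2)"
    by (auto simp: var_def simp del: One_nat_def)
  show ?thesis
  proof (rule initial_ideal_eq)
    show "ideal ?I (poly_ring 2)"
      unfolding I_eq by (rule ring.genideal_ideal[OF ring_poly_ring var])
    show "b \<in> standard 2" if "a + b \<in> standard 2" for a b
      using that by (rule standard_divisor_closed)
  next
    fix p assume p: "p \<in> ?I" "p \<noteq> 0"
    have nz: "Poly_Mapping.single i (1::nat) \<noteq> 0" for i :: nat
      by (metis lookup_single_eq lookup_zero zero_neq_one)
    have "coeff_sum {0} p = 0"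
      by (rule coeff_sum_ideal[OF var, where \<C> = "{C. C \<subseteq> {0}}"])
        (use p I_eq nz in \<open>auto simp: var_def mon_add_eq_zero_iff\<close>)
    moreover have "coeff_sum {0} p = coefficient p 0"
      by (auto simp: coeff_sum_def in_keys_iff)
    ultimately have "0 \<notin> support p" by (simp add: in_keys_iff)
    then show "leading_mon p \<notin> standard 2"
      using leading_mon_in_support[OF p(2)] by (auto simp: standard_2)
  next
    fix m assume m: "m \<in> monomials 2" "m \<notin> standard 2"
    have "\<exists>i\<in>{1, 2}. exponent m i \<noteq> 0"
    proof (rule ccontr)
      assume no: "\<not> ?thesis"
      have "exponent m i = 0" for i
        using m(1) no
        by (cases "i \<in> {1..2}") (auto simp: in_monomials_iff numeral_2_eq_2 le_Suc_eq)
      then have "m = 0" by (intro poly_mapping_eqI) simp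
      then show False using m(2) by (simp add: standard_2)
    qed
    then obtain i where i: "i \<in> {1, 2}" "exponent m i \<noteq> 0" by blast
    have "var i \<in> ?I"
      unfolding I_eq using ring.genideal_self[OF ring_poly_ring var] i(1) by blast
    moreover have "leading_mon (var i :: 'a mpol) = Poly_Mapping.single i 1"
      unfolding var_def by (rule leading_mon_monomial)
    moreover have "var i \<noteq> (0 :: 'a mpol)"
      using support_monomial[of "Poly_Mapping.single i 1"] keys_zero unfolding var_def
      by (metis insert_not_empty)
    moreover have "m = (m - Poly_Mapping.single i 1) + Poly_Mapping.single i 1"
      using i(2) by (intro divides_monI) (auto simp: lookup_single when_def)
    ultimately show "\<exists>p\<in>?I. \<exists>a. p \<noteq> 0 \<and> m = a + leading_mon p" by metis
  qed
qed

section \<open>Counting standard monomials\<close>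

text \<open>
  In degree $k$ the exponent of $x_n$ is $k - |S|$, so the defining bound $2|S| + e \le 2n-4$
  becomes $|S| + k \le 2n-4$.
\<close>

lemma bij_betw_standard:
  assumes n: "n \<ge> 2"
  shows "bij_betw (\<lambda>S. squarefree_mon S + Poly_Mapping.single n (k - card S))
    {S. S \<subseteq> {1..<n} \<and> card S \<le> k \<and> card S + k \<le> 2 * n - 4}
    {b \<in> standard n. mon_deg b = k}" (is "bij_betw ?f ?X ?Y")
proof (rule bij_betw_byWitness[where f' = "\<lambda>m. {i \<in> {1..<n}. exponent m i = 1}"])
  have fin: "finite S" if "S \<subseteq> {1..<n}" for S using that finite_subset by blast
  have exp: "exponent (?f S) i = (if i \<in> S then 1 else if i = n then k - card S else 0)"
    if "S \<subseteq> {1..<n}" for S i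
    using that fin[OF that] by (auto simp: lookup_add lookup_single when_def)
  have sum_exp: "(\<Sum>i\<in>{1..<n}. exponent (?f S) i) = card S" if "S \<subseteq> {1..<n}" for S
  proof -
    have "(\<Sum>i\<in>{1..<n}. exponent (?f S) i) = (\<Sum>i\<in>{1..<n}. if i \<in> S then 1 else 0)"
      by (intro sum.cong refl) (use exp[OF that] in auto)
    also have "\<dots> = card S" using that by (simp add: sum.If_cases Int_absorb1)
    finally show ?thesis .
  qed
  show "\<forall>S\<in>?X. {i \<in> {1..<n}. exponent (?f S) i = 1} = S"
  proof
    fix S assume "S \<in> ?X"
    then have S: "S \<subseteq> {1..<n}" by blast
    show "{i \<in> {1..<n}. exponent (?f S) i = 1} = S"
      unfolding exp[OF S] using S by auto
  qed
  show "?f ` ?X \<subseteq> ?Y"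
  proof clarify
    fix S assume S: "S \<subseteq> {1..<n}" "card S \<le> k" "card S + k \<le> 2 * n - 4"
    have "?f S \<in> monomials n"
      using S(1) n by (auto intro!: squarefree_in_monomials)
    moreover have "exponent (?f S) n = k - card S" using exp[OF S(1), of n] S(1) by auto
    moreover have "\<forall>i\<in>{1..<n}. exponent (?f S) i \<le> 1" using exp[OF S(1)] by auto
    ultimately have "?f S \<in> standard n"
      using sum_exp[OF S(1)] S by (simp add: standard_def)
    then show "?f S \<in> standard n \<and> mon_deg (?f S) = k" using S(2) by simp
  qed
  have *: "(\<Sum>i\<in>{1..<n}. exponent m i) = card {i \<in> {1..<n}. exponent m i = 1}"
    if "m \<in> standard n" for m
  proof -
    have "(\<Sum>i\<in>{1..<n}. exponent m i) = (\<Sum>i\<in>{1..<n}. if exponent m i = 1 then 1 else 0)"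
      using that by (intro sum.cong) (auto simp: standard_def le_Suc_eq)
    also have "\<dots> = card {i \<in> {1..<n}. exponent m i = 1}"
      by (simp add: sum.If_cases Int_def)
    finally show ?thesis .
  qed
  have deg: "mon_deg m = card {i \<in> {1..<n}. exponent m i = 1} + exponent m n"
    if "m \<in> standard n" for m
    using mon_deg_monomials[of m n] *[OF that] that n by (simp add: standard_def)
  show "\<forall>m\<in>?Y. ?f {i \<in> {1..<n}. exponent m i = 1} = m"
  proof
    fix m assume m: "m \<in> ?Y"
    let ?S = "{i \<in> {1..<n}. exponent m i = 1}"
    have S: "?S \<subseteq> {1..<n}" by auto
    have le: "exponent m i \<le> 1" if "i \<in> {1..<n}" for i using m that by (simp add: standard_def)
    have out: "exponent m i = 0" if "i \<notin> {1..n}" for i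
      using m that by (auto simp: standard_def in_monomials_iff)
    show "?f ?S = m"
    proof (rule poly_mapping_eqI)
      fix i
      consider "i = n" | "i \<in> {1..<n}" | "i \<notin> {1..n}" by force
      then show "exponent (?f ?S) i = exponent m i"
      proof cases
        case 1
        then show ?thesis using deg[of m] m unfolding exp[OF S] by simp
      next
        case 2
        then show ?thesis using le[of i] unfolding exp[OF S] by auto
      next
        case 3
        then show ?thesis using out[of i] n unfolding exp[OF S] by auto
      qed
    qed
  qed
  show "(\<lambda>m. {i \<in> {1..<n}. exponent m i = 1}) ` ?Y \<subseteq> ?X"
  proof clarify
    fix m assume m: "m \<in> standard n" "k = mon_deg m"
    show "{i \<in> {1..<n}. exponent m i = 1} \<subseteq> {1..<n} \<and>
      card {i \<in> {1..<n}. exponent m i = 1} \<le> mon_deg m \<and>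
      card {i \<in> {1..<n}. exponent m i = 1} + mon_deg m \<le> 2 * n - 4"
      using deg[OF m(1)] *[OF m(1)] m(1) by (auto simp: standard_def)
  qed
qed

lemma card_subsets_bounded:
  assumes "finite A"
  shows "card {S. S \<subseteq> A \<and> card S \<le> r} = bernoulli_b (card A) r"
proof -
  have "{S. S \<subseteq> A \<and> card S \<le> r} = (\<Union>j\<in>{0..r}. {S. S \<subseteq> A \<and> card S = j})" by auto
  also have "card \<dots> = (\<Sum>j\<in>{0..r}. card {S. S \<subseteq> A \<and> card S = j})"
    using assms by (intro card_UN_disjoint) auto
  also have "\<dots> = bernoulli_b (card A) r"
    using assms by (simp add: n_subsets bernoulli_b_def)
  finally show ?thesis .
qed

lemma card_standard:
  assumes n: "n \<ge> 2"
  shows "card {b \<in> standard n. mon_deg b = k} = (if k \<le> 2 * n - 4 then bernoulli_a n k else 0)"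
proof -
  let ?X = "{S. S \<subseteq> {1..<n} \<and> card S \<le> k \<and> card S + k \<le> 2 * n - 4}"
  have "card {b \<in> standard n. mon_deg b = k} = card ?X"
    using bij_betw_same_card[OF bij_betw_standard[OF n]] by simp
  also have "\<dots> = (if k \<le> 2 * n - 4 then bernoulli_a n k else 0)"
  proof (cases "k \<le> 2 * n - 4")
    case True
    then have "?X = {S. S \<subseteq> {1..<n} \<and> card S \<le> min k (2 * n - 4 - k)}" by auto
    then have "card ?X = bernoulli_b (n - 1) (min k (2 * n - 4 - k))"
      using card_subsets_bounded[of "{1..<n}" "min k (2 * n - 4 - k)"]
      by (simp only: finite_atLeastLessThan card_atLeastLessThan)
    moreover have "min k (2 * n - 4 - k) = (if k \<le> n - 2 then k else 2 * n - 4 - k)"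
      using n by auto
    ultimately show ?thesis using True by (simp add: bernoulli_a_def)
  next
    case False
    then have "?X = {}" by auto
    then show ?thesis using False by (simp only: card.empty if_False)
  qed
  finally show ?thesis .
qed

lemma finite_standard:
  assumes "n \<ge> 2"
  shows "finite {b \<in> standard n. mon_deg b = k}"
proof -
  have "finite {S. S \<subseteq> {1..<n} \<and> card S \<le> k \<and> card S + k \<le> 2 * n - 4}"
    by (rule finite_subset[of _ "Pow {1..<n}"]) auto
  then show ?thesis using bij_betw_finite[OF bij_betw_standard[OF assms]] by blast
qed

section \<open>The Hilbert series\<close>

theorem theorem3p1:
  fixes n :: nat
  assumes "n \<ge> 2"
  shows "hilbert_series n (ideal_J n :: 'a::{alg_closed_field, field_char_0} mpol set) =
           (\<Sum>k=0..2 * n - 4. fps_const (int (bernoulli_a n k)) * fps_X ^ k)"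
proof (rule fps_ext)
  fix k
  let ?J = "ideal_J n :: 'a mpol set"
  have J: "?J = {p \<in> carrier (poly_ring n). support p \<inter> standard n = {}}"
  proof (cases "n = 2")
    case True
    then show ?thesis using initial_ideal_standard_2 by (simp add: ideal_J_def)
  next
    case False
    then show ?thesis using initial_ideal_standard[of n] assms by (simp add: ideal_J_def)
  qed
  have "hilbert_function n ?J k = card {b \<in> standard n. mon_deg b = k}"
  proof (rule hilbert_function_eq_card[OF J])
    show "standard n \<subseteq> monomials n" by (auto simp: standard_def)
    show "b \<in> standard n" if "a + b \<in> standard n" for a b
      using that by (rule standard_divisor_closed)
  qed (use finite_standard[OF assms] in simp_all)
  also have "\<dots> = (if k \<le> 2 * n - 4 then bernoulli_a n k else 0)"
    by (rule card_standard[OF assms])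
  finally have "fps_nth (hilbert_series n ?J) k = int (if k \<le> 2 * n - 4 then bernoulli_a n k else 0)"
    by (simp add: hilbert_series_def)
  also have "\<dots> = (\<Sum>j=0..2 * n - 4. if j = k then int (bernoulli_a n j) else 0)"
    by simp
  also have "\<dots> =
      fps_nth (\<Sum>j=0..2 * n - 4. fps_const (int (bernoulli_a n j)) * fps_X ^ j) k"
    unfolding fps_sum_nth by (rule sum.cong) (auto simp: fps_X_power_nth)
  finally show "fps_nth (hilbert_series n ?J) k =
      fps_nth (\<Sum>k=0..2 * n - 4. fps_const (int (bernoulli_a n k)) * fps_X ^ k) k" .
qed

end
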